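(* Let $(X,d_X)$ and $(Y,d_Y)$ be polyhedral Hilbert geometries in $\mathbb{R}^n$ and let $g\colon X\to Y$ be an isometry (onto). If $g$ extends to a continuous map $\overline X\to\overline Y$ and $g^{-1}$ extends to a continuous map $\overline Y\to\overline X$, then $g$ is a collineation, i.e. there is a projective transformation $h$ of $\mathbb{P}^n$ with $h(x)=g(x)$ for all $x\in X$.
   Context: A polyhedral Hilbert geometry is a nonempty bounded set $X\subseteq\mathbb{R}^n$ which is the intersection of finitely many open half-spaces, equipped with the Hilbert metric $d_X(x,y)=\log\frac{|x'y|\,|y'x|}{|x'x|\,|y'y|}$, where $x',y'\in\partial X$ are the endpoints of the chord through $x\neq y$ with $x',x,y,y'$ in this order, and $d_X(x,x)=0$. $\mathbb{R}^n$ is the standard affine chart of $\mathbb{P}^n$. *)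

theory Defs
  imports "HOL-Analysis.Analysis"
begin

definition polyhedral_hilbert_geometry :: "(real ^ 'n) set \<Rightarrow> bool" where
  "polyhedral_hilbert_geometry X \<longleftrightarrow>
     X \<noteq> {} \<and> bounded X \<and>
     (\<exists>H :: ((real ^ 'n) \<times> real) set. finite H \<and> (\<forall>(a, b) \<in> H. a \<noteq> 0) \<and>
        X = (\<Inter>(a, b) \<in> H. {x. a \<bullet> x < b}))"

definition chord_end :: "(real ^ 'n) set \<Rightarrow> real ^ 'n \<Rightarrow> real ^ 'n \<Rightarrow> real ^ 'n" where
  "chord_end X x y = (SOME p. p \<in> frontier X \<and> x \<in> open_segment p y)"

definition hilbert_dist :: "(real ^ 'n) set \<Rightarrow> real ^ 'n \<Rightarrow> real ^ 'n \<Rightarrow> real" where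
  "hilbert_dist X x y =
     (if x = y then 0
      else (let x' = chord_end X x y; y' = chord_end X y x in
            ln ((dist x' y * dist y' x) / (dist x' x * dist y' y))))"

text \<open>A projective transformation of P^n, written in the standard affine chart:
  it is given by the invertible (n+1)x(n+1) block matrix [[A, b], [c^T, d]],
  and sends x to (A x + b) / (c.x + d).\<close>

definition proj_matrix_invertible ::
  "real ^ 'n ^ 'n \<Rightarrow> real ^ 'n \<Rightarrow> real ^ 'n \<Rightarrow> real \<Rightarrow> bool" where
  "proj_matrix_invertible A b c d \<longleftrightarrow>
     bij (\<lambda>(v :: real ^ 'n, t :: real). (A *v v + t *\<^sub>R b, c \<bullet> v + t * d))"

definition is_collineation_on :: "(real ^ 'n) set \<Rightarrow> (real ^ 'n \<Rightarrow> real ^ 'n) \<Rightarrow> bool" where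
  "is_collineation_on X g \<longleftrightarrow>
     (\<exists>A b c d. proj_matrix_invertible A b c d \<and>
        (\<forall>x \<in> X. c \<bullet> x + d \<noteq> 0 \<and> g x = (1 / (c \<bullet> x + d)) *\<^sub>R (A *v x + b)))"

end

theory Submission
  imports Defs
begin

text \<open>Let \<open>L\<^sub>i\<close> be the affine slacks of the half-spaces defining \<open>X\<close>. Then \<open>exp (d\<^sub>X(x, y)) = r(x, y) r(y, x)\<close>
  with \<open>r(u, x) = max\<^sub>j L\<^sub>j(u) / L\<^sub>j(x)\<close>. As \<open>z\<close> tends to a boundary point \<open>\<xi>\<close> lying on essentially one
  facet \<open>i\<close>, the horofunction \<open>exp (d(x, z) - d(y, z))\<close> converges, and conversely, whenever it converges at
  a boundary point \<open>\<xi>\<close>, the limit is \<open>L\<^sub>i(x) r(\<xi>, x) / (L\<^sub>i(y) r(\<xi>, y))\<close> for every \<open>i\<close> with \<open>L\<^sub>i(\<xi>) = 0\<close>.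
  The continuous extension \<open>G\<close> of the isometry transports these limits, so on \<open>X\<close> the function
  \<open>L\<^sub>i r(\<xi>, \<cdot>)\<close> is a constant multiple of the pullback of \<open>M\<^sub>j r(G \<xi>, \<cdot>)\<close>, where \<open>M\<^sub>j\<close> is a slack of \<open>Y\<close>
  vanishing at \<open>G \<xi>\<close>. Letting two such points on different facets meet removes the factors \<open>r\<close>, and since the
  boundary is connected (except in dimension one, which is checked directly), all quotients \<open>L\<^sub>i / M\<^sub>j \<circ> G\<close> are constant multiples
  of one function \<open>\<psi>\<close>. Hence \<open>(x, 1) \<mapsto> \<psi>(x) (G x, 1)\<close> is the restriction of a linear bijection.\<close>

subsection \<open>Polytopes and the Funk weak metric\<close>

definition slack :: "'a::euclidean_space \<times> real \<Rightarrow> 'a \<Rightarrow> real" where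
  "slack h x = snd h - fst h \<bullet> x"

text \<open>The exponential of the Funk weak metric. Only slacks at \<open>x\<close> are divided by,
  so \<open>u\<close> may be any point, in particular a frontier point.\<close>

definition funk :: "('a::euclidean_space \<times> real) set \<Rightarrow> 'a \<Rightarrow> 'a \<Rightarrow> real" where
  "funk H u x = Max ((\<lambda>h. slack h u / slack h x) ` H)"

lemma slack_affine: "slack h (p + s *\<^sub>R (u - p)) = (1 - s) * slack h p + s * slack h u"
  by (simp add: slack_def inner_simps algebra_simps)

lemma slack_combination: "slack h (p + s *\<^sub>R (x - p - l *\<^sub>R (y - p))) = slack h p + s * (slack h x - slack h p - l * (slack h y - slack h p))"
  by (simp add: slack_def inner_simps algebra_simps)

lemma continuous_on_slack [continuous_intros]:
  "continuous_on A f \<Longrightarrow> continuous_on A (\<lambda>x. slack h (f x))"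
  unfolding slack_def by (intro continuous_intros)

lemma continuous_on_Max_image:
  fixes f :: "'i \<Rightarrow> 'b::topological_space \<Rightarrow> real"
  assumes "finite I" "I \<noteq> {}" "\<And>i. i \<in> I \<Longrightarrow> continuous_on A (f i)"
  shows "continuous_on A (\<lambda>x. Max ((\<lambda>i. f i x) ` I))"
  using assms
proof (induction I rule: finite_ne_induct)
  case (insert i I)
  have "Max ((\<lambda>i. f i x) ` insert i I) = max (f i x) (Max ((\<lambda>i. f i x) ` I))" for x
    using insert by simp
  then show ?case
    using insert by (simp add: continuous_on_max)
qed simp

locale open_polytope =
  fixes H :: "('a::euclidean_space \<times> real) set" and X :: "'a set"
  assumes finite_H: "finite H"
    and X_eq: "X = {x. \<forall>h\<in>H. 0 < slack h x}"
    and nonempty_X: "X \<noteq> {}"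
    and bounded_X: "bounded X"
begin

lemma nonempty_H: "H \<noteq> {}"
proof
  assume "H = {}"
  then have "X = UNIV" using X_eq by simp
  then show False using bounded_X by simp
qed

lemma open_X: "open X"
proof -
  have "X = (\<Inter>h\<in>H. {x. 0 < slack h x})" using X_eq by auto
  moreover have "open (\<Inter>h\<in>H. {x. 0 < slack h x})"
    using finite_H by (intro open_INT ballI open_Collect_less continuous_intros) auto
  ultimately show ?thesis by simp
qed

lemma convex_halfspace: "convex {x. 0 < slack h x}"
  using convex_halfspace_lt[of "fst h" "snd h"] by (simp add: slack_def)

lemma convex_X: "convex X"
proof -
  have "X = (\<Inter>h\<in>H. {x. 0 < slack h x})" using X_eq by auto
  then show ?thesis using convex_halfspace by (metis (mono_tags, lifting) convex_INT)
qed

lemma slack_pos: "x \<in> X \<Longrightarrow> h \<in> H \<Longrightarrow> 0 < slack h x"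
  using X_eq by auto

lemma slack_closure: assumes "x \<in> closure X" "h \<in> H" shows "0 \<le> slack h x"
proof -
  have "closed {x. 0 \<le> slack h x}" by (intro closed_Collect_le continuous_intros)
  moreover have "X \<subseteq> {x. 0 \<le> slack h x}" using slack_pos[OF _ assms(2)] less_imp_le by blast
  ultimately have "closure X \<subseteq> {x. 0 \<le> slack h x}" by (rule closure_minimal[rotated])
  then show ?thesis using assms by auto
qed

lemma frontierD: assumes "p \<in> frontier X" shows "p \<in> closure X" "p \<notin> X"
  using assms open_X by (auto simp: frontier_def interior_open)

lemma frontier_slack: "p \<in> frontier X \<Longrightarrow> h \<in> H \<Longrightarrow> 0 \<le> slack h p"
  using slack_closure frontierD by blast

lemma frontier_active: assumes "p \<in> frontier X" obtains h where "h \<in> H" "slack h p = 0"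
proof -
  obtain h where "h \<in> H" "slack h p \<le> 0" using frontierD[OF assms] X_eq by force
  then show ?thesis using frontier_slack[OF assms, of h] that by simp
qed

lemma ray_frontier: assumes "x \<in> X" "v \<noteq> 0" obtains s where "0 < s" "x + s *\<^sub>R v \<in> frontier X"
  using ray_to_frontier[of X x v] assms bounded_X open_X by (metis interior_open)

lemma frontier_segment:
  assumes "p \<in> frontier X" "x \<in> X" "0 < t" "t \<le> 1"
  shows "p + t *\<^sub>R (x - p) \<in> X"
proof -
  have "0 < slack h (p + t *\<^sub>R (x - p))" if "h \<in> H" for h
    using frontier_slack[OF assms(1) that] slack_pos[OF assms(2) that] assms(3,4)
    by (simp add: slack_affine add_nonneg_pos)
  then show ?thesis using X_eq by auto
qed

lemma le_funk: "h \<in> H \<Longrightarrow> slack h u / slack h x \<le> funk H u x"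
  unfolding funk_def using finite_H by auto

text \<open>Slacks are affine along the chord and nonnegative at \<open>p\<close>, which bounds
  every ratio by \<open>1 / s\<close>; a half-space active at \<open>p\<close> attains the
  bound.\<close>

lemma funk_chord:
  assumes "p \<in> frontier X" "0 < s" "s \<le> 1" "x \<in> X" and x: "x = p + s *\<^sub>R (u - p)"
  shows "funk H u x = 1 / s"
  unfolding funk_def
proof (rule Max_eqI)
  obtain k where k: "k \<in> H" "slack k p = 0" using frontier_active[OF assms(1)] .
  have "slack k x = s * slack k u" using k x by (simp add: slack_affine)
  then show "1 / s \<in> (\<lambda>h. slack h u / slack h x) ` H"
    using slack_pos[OF assms(4) k(1)] k(1) assms(2)
    by (intro image_eqI[of _ _ k]) (auto simp: field_simps zero_less_mult_iff)
next
  fix r assume "r \<in> (\<lambda>h. slack h u / slack h x) ` H"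
  then obtain h where h: "h \<in> H" "r = slack h u / slack h x" by auto
  have "slack h x = (1 - s) * slack h p + s * slack h u" using x by (simp add: slack_affine)
  then have "s * slack h u \<le> slack h x"
    using frontier_slack[OF assms(1) h(1)] assms(3) by simp
  then show "r \<le> 1 / s"
    using h(2) slack_pos[OF assms(4) h(1)] assms(2) by (simp add: divide_le_eq le_divide_eq mult.commute)
qed (use finite_H in auto)

lemma funk_self [simp]: "x \<in> X \<Longrightarrow> funk H x x = 1"
proof -
  assume "x \<in> X"
  then have "(\<lambda>h. slack h x / slack h x) ` H = {1}"
    using nonempty_H slack_pos by (force simp: image_iff)
  then show ?thesis by (simp add: funk_def)
qed

text \<open>Slacks at an arbitrary \<open>u\<close> can be negative. Prolonging the ray from
  \<open>u\<close> past \<open>x\<close> until it meets the frontier makes \<open>funk_chord\<close>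
  applicable.\<close>

lemma funk_pos: assumes "x \<in> X" shows "0 < funk H u x"
proof (cases "u = x")
  case False
  then obtain s where s: "0 < s" "x + s *\<^sub>R (x - u) \<in> frontier X"
    using ray_frontier[OF assms, of "x - u"] by auto
  let ?p = "x + s *\<^sub>R (x - u)" and ?t = "s / (1 + s)"
  have "u - ?p = (1 + s) *\<^sub>R (u - x)" by (simp add: algebra_simps)
  then have "?t *\<^sub>R (u - ?p) = s *\<^sub>R (u - x)" using s by simp
  then have "?p + ?t *\<^sub>R (u - ?p) = x" by (simp add: algebra_simps)
  then have "funk H u x = 1 / ?t"
    using s assms by (intro funk_chord) auto
  then show ?thesis using s by simp
qed (use assms in simp)

lemma continuous_on_funk:
  "x \<in> X \<Longrightarrow> continuous_on A f \<Longrightarrow> continuous_on A (\<lambda>z. funk H (f z) x)"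
  unfolding funk_def using finite_H nonempty_H slack_pos
  by (intro continuous_on_Max_image continuous_intros) fastforce+

section \<open>Smooth frontier points and limits of horofunctions\<close>

definition hratio :: "'a \<Rightarrow> 'a \<Rightarrow> real" where
  "hratio x y = funk H x y * funk H y x"

lemma hratio_pos: "x \<in> X \<Longrightarrow> y \<in> X \<Longrightarrow> 0 < hratio x y"
  by (simp add: hratio_def funk_pos)

text \<open>Redundant or duplicate half-spaces are allowed in \<open>H\<close>, so smoothness is expressed by proportionality
  of all active slacks rather than by uniqueness of the active half-space.\<close>

definition smooth :: "'a \<Rightarrow> bool" where
  "smooth p \<longleftrightarrow> p \<in> frontier X \<and>
     (\<forall>i\<in>H. \<forall>k\<in>H. slack i p = 0 \<longrightarrow> slack k p = 0 \<longrightarrow>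
        (\<forall>x\<in>X. \<forall>y\<in>X. slack i x * slack k y = slack k x * slack i y))"

text \<open>If the slacks of \<open>i\<close> and \<open>k\<close> are not proportional, some
  direction at \<open>p\<close> leaves the half-space \<open>i\<close> while entering
  \<open>k\<close>. A short segment from a point of \<open>X\<close> to a point displaced in that
  direction stays inside \<open>k\<close> and crosses the frontier.\<close>

lemma frontier_avoiding:
  assumes p: "p \<in> frontier X" and U: "open U" "convex U" "p \<in> U"
    and ik: "i \<in> H" "k \<in> H" "slack i p = 0" "slack k p = 0"
    and xy: "x \<in> X" "y \<in> X" "slack i x * slack k y < slack k x * slack i y"
  obtains q where "q \<in> frontier X" "q \<in> U" "0 < slack k q"
proof -
  have pos: "0 < slack i y" "0 < slack k y" "0 < slack k x"
    using ik xy slack_pos by auto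
  have "slack i x / slack i y < slack k x / slack k y"
    using xy(3) pos by (simp add: field_simps)
  \<comment> \<open>With \<open>l\<close> strictly between the two ratios, the direction
    \<open>x - p - l *\<^sub>R (y - p)\<close> decreases the slack of \<open>i\<close> and increases
    that of \<open>k\<close>.\<close>
  then obtain l where l: "slack i x / slack i y < l" "l < slack k x / slack k y"
    using dense by blast
  have l': "slack i x - l * slack i y < 0" "0 < slack k x - l * slack k y"
    using l pos by (auto simp: field_simps)
  define a where "a s = p + s *\<^sub>R (x - p)" for s
  define b where "b s = p + s *\<^sub>R (x - p - l *\<^sub>R (y - p))" for s
  have "((\<lambda>s. a s) \<longlongrightarrow> p + 0 *\<^sub>R (x - p)) (at_right 0)"
    unfolding a_def by (intro tendsto_intros)
  then have ea: "\<forall>\<^sub>F s in at_right 0. a s \<in> U"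
    using U by (simp add: topological_tendstoD)
  have "((\<lambda>s. b s) \<longlongrightarrow> p + 0 *\<^sub>R (x - p - l *\<^sub>R (y - p))) (at_right 0)"
    unfolding b_def by (intro tendsto_intros)
  then have eb: "\<forall>\<^sub>F s in at_right 0. b s \<in> U"
    using U by (simp add: topological_tendstoD)
  have "\<forall>\<^sub>F s in at_right 0. s \<in> {0<..<1::real}"
    by (intro eventually_at_right_real) simp
  then have "\<forall>\<^sub>F s in at_right 0. a s \<in> U \<and> b s \<in> U \<and> 0 < s \<and> s < 1"
    using ea eb by eventually_elim auto
  then obtain s where s: "a s \<in> U" "b s \<in> U" "0 < s" "s < 1"
    using eventually_happens trivial_limit_at_right_real by blast
  have aX: "a s \<in> X" unfolding a_def using frontier_segment p xy s by simp
  have "slack i (b s) < 0" "0 < slack k (b s)"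
    using ik l' s by (simp_all add: b_def slack_combination mult_pos_neg)
  then have bX: "b s \<notin> X" using slack_pos ik by fastforce
  have "closed_segment (a s) (b s) \<inter> frontier X \<noteq> {}"
    using aX bX by (intro connected_Int_frontier connected_segment) auto
  then obtain q where q: "q \<in> closed_segment (a s) (b s)" "q \<in> frontier X" by auto
  have "q \<in> U" using q s U closed_segment_subset by blast
  moreover have "closed_segment (a s) (b s) \<subseteq> {x. 0 < slack k x}"
    using \<open>0 < slack k (b s)\<close> slack_pos[OF aX ik(2)]
    by (intro closed_segment_subset convex_halfspace) auto
  ultimately show ?thesis using q that by auto
qed

text \<open>In any neighbourhood, a frontier point with the fewest active half-spaces is smooth.\<close>

lemma smooth_dense: "frontier X \<subseteq> closure (Collect smooth)"
proof
  fix p0 assume p0: "p0 \<in> frontier X"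
  show "p0 \<in> closure (Collect smooth)"
    unfolding closure_approachable
  proof safe
    fix e :: real assume e: "0 < e"
    define act where "act p = {h\<in>H. slack h p = 0}" for p
    have "\<exists>p. (p \<in> frontier X \<and> p \<in> ball p0 e) \<and>
        (\<forall>q. q \<in> frontier X \<and> q \<in> ball p0 e \<longrightarrow> card (act p) \<le> card (act q))"
      using p0 e by (intro ex_has_least_nat[of _ p0]) auto
    then obtain p where p: "p \<in> frontier X" "p \<in> ball p0 e"
      and least: "\<And>q. q \<in> frontier X \<Longrightarrow> q \<in> ball p0 e \<Longrightarrow> card (act p) \<le> card (act q)"
      by blast
    \<comment> \<open>Half-spaces inactive at \<open>p\<close> remain inactive throughout
      \<open>U\<close>, so active sets can only shrink there; losing \<open>k\<close> as well would
      contradict minimality.\<close>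
    define U where "U = ball p0 e \<inter> (\<Inter>h\<in>{h\<in>H. 0 < slack h p}. {u. 0 < slack h u})"
    have "open U" unfolding U_def
      using finite_H by (intro open_Int open_INT ballI open_Collect_less continuous_intros) auto
    moreover have "convex U" unfolding U_def
      by (intro convex_Int convex_ball convex_INT convex_halfspace)
    moreover have "p \<in> U" unfolding U_def using p by auto
    ultimately have U: "open U" "convex U" "p \<in> U" .
    have no: "\<not> slack i x * slack k y < slack k x * slack i y"
      if ik: "i \<in> H" "k \<in> H" "slack i p = 0" "slack k p = 0" and xy: "x \<in> X" "y \<in> X" for i k x y
    proof
      assume "slack i x * slack k y < slack k x * slack i y"
      then obtain q where q: "q \<in> frontier X" "q \<in> U" "0 < slack k q"
        using frontier_avoiding[OF p(1) U ik xy] by blast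
      have "act q \<subseteq> act p" using q frontier_slack[OF p(1)] by (force simp: act_def U_def)
      moreover have "k \<in> act p" "k \<notin> act q" using ik q by (auto simp: act_def)
      ultimately have "act q \<subset> act p" by blast
      then have "card (act q) < card (act p)"
        using finite_H by (intro psubset_card_mono) (auto simp: act_def)
      then show False using least[of q] q by (auto simp: U_def)
    qed
    have "slack i x * slack k y = slack k x * slack i y"
      if "i \<in> H" "k \<in> H" "slack i p = 0" "slack k p = 0" "x \<in> X" "y \<in> X" for i k x y
      using no[of i k x y] no[of k i x y] that by (simp add: mult.commute)
    then have "smooth p" using p unfolding smooth_def by blast
    then show "\<exists>y\<in>Collect smooth. dist y p0 < e"
      using p by (auto simp: dist_commute)
  qed
qed

text \<open>The factor \<open>slack i z\<close> cancels the blow-up of \<open>funk H x z\<close>. By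
  smoothness each active half-space contributes exactly \<open>slack i x\<close>, while the
  contributions of inactive ones tend to zero; the product is therefore eventually constant.\<close>

lemma smooth_funk_tendsto:
  assumes p: "smooth p" and i: "i \<in> H" "slack i p = 0" and x: "x \<in> X"
  shows "((\<lambda>z. slack i z * funk H x z) \<longlongrightarrow> slack i x) (at p within X)"
proof -
  have s: "((\<lambda>z. slack h z) \<longlongrightarrow> slack h p) (at p within X)" for h
    unfolding slack_def by (intro tendsto_intros)
  have "\<forall>\<^sub>F z in at p within X. slack h x * slack i z / slack h z \<le> slack i x" if h: "h \<in> H" for h
  proof (cases "slack h p = 0")
    case True
    have "slack h x * slack i z / slack h z \<le> slack i x" if "z \<in> X" for z
    proof -
      have "slack i x * slack h z = slack h x * slack i z"
        using p i h True x that unfolding smooth_def by blast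
      then show ?thesis using slack_pos[OF that h] by (simp add: field_simps)
    qed
    then show ?thesis by (auto simp: eventually_at_filter)
  next
    case False
    have "((\<lambda>z. slack h x * slack i z / slack h z) \<longlongrightarrow> slack h x * slack i p / slack h p) (at p within X)"
      using False by (intro tendsto_intros s)
    then have "((\<lambda>z. slack h x * slack i z / slack h z) \<longlongrightarrow> 0) (at p within X)"
      using i by simp
    from order_tendstoD(2)[OF this slack_pos[OF x i(1)]] show ?thesis
      by (rule eventually_mono) simp
  qed
  then have "\<forall>\<^sub>F z in at p within X. \<forall>h\<in>H. slack h x * slack i z / slack h z \<le> slack i x"
    using finite_H by (simp add: eventually_ball_finite)
  moreover have "\<forall>\<^sub>F z in at p within X. z \<in> X" by (auto simp: eventually_at_filter)
  ultimately have "\<forall>\<^sub>F z in at p within X. slack i z * funk H x z = slack i x"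
  proof eventually_elim
    case (elim z)
    have iz: "0 < slack i z" using slack_pos elim i by simp
    have "funk H x z = slack i x / slack i z"
      unfolding funk_def
    proof (rule Max_eqI)
      fix r assume "r \<in> (\<lambda>h. slack h x / slack h z) ` H"
      then obtain h where h: "h \<in> H" "r = slack h x / slack h z" by auto
      have "slack h x * slack i z / slack h z \<le> slack i x" using elim h by auto
      then show "r \<le> slack i x / slack i z" using h iz by (simp add: field_simps)
    qed (use finite_H i in auto)
    then show ?case using iz by simp
  qed
  then show ?thesis by (rule tendsto_eventually)
qed

lemma tendsto_funk: "x \<in> X \<Longrightarrow> ((\<lambda>z. funk H z x) \<longlongrightarrow> funk H p x) (at p within A)"
  using continuous_on_funk[of x UNIV "\<lambda>z. z"]
  by (metis continuous_on_id continuous_on_eq_continuous_within continuous_within tendsto_within_subset UNIV_I subset_UNIV)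

text \<open>Inserting \<open>slack i z\<close> in numerator and denominator leaves the quotient
  unchanged and makes both converge to positive limits.\<close>

lemma smooth_hratio_limit:
  assumes p: "smooth p" and x: "x \<in> X" "y \<in> X"
  obtains l where "((\<lambda>z. hratio x z / hratio y z) \<longlongrightarrow> l) (at p within X)"
proof -
  obtain i where i: "i \<in> H" "slack i p = 0" using p frontier_active unfolding smooth_def by blast
  have "((\<lambda>z. (slack i z * funk H x z) * funk H z x / ((slack i z * funk H y z) * funk H z y))
     \<longlongrightarrow> slack i x * funk H p x / (slack i y * funk H p y)) (at p within X)"
    using slack_pos[OF x(2) i(1)] funk_pos[OF x(2), of p]
    by (intro tendsto_intros smooth_funk_tendsto[OF p i] tendsto_funk x) auto
  moreover have "\<forall>\<^sub>F z in at p within X. (slack i z * funk H x z) * funk H z x / ((slack i z * funk H y z) * funk H z y)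
     = hratio x z / hratio y z"
  proof (unfold eventually_at_filter, intro always_eventually allI impI)
    fix z assume "z \<in> X"
    then have "slack i z \<noteq> 0" using slack_pos[OF _ i(1), of z] by simp
    then show "(slack i z * funk H x z) * funk H z x / ((slack i z * funk H y z) * funk H z y)
       = hratio x z / hratio y z" by (simp add: hratio_def)
  qed
  ultimately show ?thesis using that tendsto_cong by force
qed

text \<open>Approach \<open>p\<close> along the chord towards \<open>y\<close>, where \<open>funk H y z\<close> is explicit; exchanging \<open>x\<close> and \<open>y\<close>
  turns this bound into the equality below.\<close>

lemma hratio_limit_ge:
  assumes p: "p \<in> frontier X" and k: "k \<in> H" "slack k p = 0" and x: "x \<in> X" "y \<in> X"
    and l: "((\<lambda>z. hratio x z / hratio y z) \<longlongrightarrow> l) (at p within X)"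
  shows "slack k x * funk H p x / (slack k y * funk H p y) \<le> l"
proof -
  define z where "z t = p + t *\<^sub>R (y - p)" for t
  have small: "\<forall>\<^sub>F t in at_right 0. t \<in> {0<..<1::real}"
    by (intro eventually_at_right_real) simp
  have zX: "z t \<in> X" if "0 < t" "t < 1" for t
    unfolding z_def using frontier_segment p x that by simp
  have "(z \<longlongrightarrow> p + 0 *\<^sub>R (y - p)) (at_right 0)" unfolding z_def by (intro tendsto_intros)
  then have z0: "(z \<longlongrightarrow> p) (at_right 0)" by simp
  have "\<forall>\<^sub>F t in at_right 0. z t \<in> X \<and> z t \<noteq> p"
    using small by (rule eventually_mono) (use zX frontierD(2)[OF p] in fastforce)
  then have zl: "filterlim z (at p within X) (at_right 0)"
    unfolding filterlim_at using z0 by simp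
  have "((\<lambda>t. hratio x (z t) / hratio y (z t)) \<longlongrightarrow> l) (at_right 0)"
    using filterlim_compose[OF l zl] .
  moreover have "((\<lambda>t. slack k x / slack k y * (funk H (z t) x / funk H (z t) y)) \<longlongrightarrow>
      slack k x / slack k y * (funk H p x / funk H p y)) (at_right 0)"
    using funk_pos[OF x(2), of p]
    by (intro tendsto_intros filterlim_compose[OF tendsto_funk zl] x) auto
  moreover have "\<forall>\<^sub>F t in at_right 0. slack k x / slack k y * (funk H (z t) x / funk H (z t) y)
      \<le> hratio x (z t) / hratio y (z t)"
    using small
  proof eventually_elim
    case (elim t)
    have "funk H y (z t) = 1 / t"
      using elim p zX by (intro funk_chord[of p]) (auto simp: z_def)
    moreover have "slack k (z t) = t * slack k y" using k by (simp add: z_def slack_affine)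
    then have "slack k x / (t * slack k y) \<le> funk H x (z t)"
      using le_funk[OF k(1), of x "z t"] by simp
    then have "t * (slack k x / (t * slack k y)) \<le> t * funk H x (z t)"
      using elim by (intro mult_left_mono) auto
    ultimately have "slack k x / slack k y \<le> funk H x (z t) / funk H y (z t)"
      using elim by (simp add: mult.commute)
    then have "slack k x / slack k y * (funk H (z t) x / funk H (z t) y) \<le>
      funk H x (z t) / funk H y (z t) * (funk H (z t) x / funk H (z t) y)"
      using funk_pos[OF x(1), of "z t"] funk_pos[OF x(2), of "z t"]
      by (intro mult_right_mono) auto
    then show ?case by (simp add: hratio_def)
  qed
  ultimately have "slack k x / slack k y * (funk H p x / funk H p y) \<le> l"
    by (intro tendsto_le[of "at_right (0::real)"]) auto
  then show ?thesis by simp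
qed

text \<open>Convergence is assumed here in place of smoothness because the lemma is also applied at
  \<open>G p\<close>, where convergence is what the isometry transports.\<close>

lemma hratio_limit:
  assumes p: "p \<in> frontier X" and k: "k \<in> H" "slack k p = 0" and x: "x \<in> X" "y \<in> X"
    and l: "((\<lambda>z. hratio x z / hratio y z) \<longlongrightarrow> l) (at p within X)"
  shows "l = slack k x * funk H p x / (slack k y * funk H p y)"
proof -
  have pos: "0 < slack k x * funk H p x" "0 < slack k y * funk H p y"
    using slack_pos k x funk_pos by auto
  have ge: "slack k x * funk H p x / (slack k y * funk H p y) \<le> l"
    using hratio_limit_ge[OF assms] .
  then have lpos: "0 < l" using pos by (meson divide_pos_pos less_le_trans)
  have "((\<lambda>z. inverse (hratio x z / hratio y z)) \<longlongrightarrow> inverse l) (at p within X)"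
    using lpos by (intro tendsto_inverse l) auto
  then have "((\<lambda>z. hratio y z / hratio x z) \<longlongrightarrow> inverse l) (at p within X)" by simp
  from hratio_limit_ge[OF p k x(2,1) this]
  have "slack k y * funk H p y * l \<le> slack k x * funk H p x"
    using pos(1) lpos by (simp add: divide_le_eq inverse_eq_divide field_simps)
  moreover have "slack k x * funk H p x \<le> slack k y * funk H p y * l"
    using ge pos(2) by (simp add: divide_le_eq mult.commute)
  ultimately have "slack k x * funk H p x = slack k y * funk H p y * l" by simp
  then show ?thesis using pos(2) by (metis less_irrefl nonzero_mult_div_cancel_left)
qed

text \<open>The homogenized slacks in \<open>N\<close> separate points. If all of them kill
  \<open>(u, t)\<close> and \<open>t *\<^sub>R x\<close> differs from \<open>u\<close>, they stay
  positive along a ray from \<open>x\<close> parallel to \<open>t *\<^sub>R x - u\<close>, yet one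
  of them vanishes where the ray meets the frontier.\<close>

lemma slack_homogeneous_zero:
  assumes N: "N \<subseteq> H" "\<And>p. p \<in> frontier X \<Longrightarrow> \<exists>h\<in>N. slack h p = 0"
    and z: "\<And>h. h \<in> N \<Longrightarrow> (- fst h, snd h) \<bullet> w = 0"
  shows "w = 0"
proof -
  obtain u t where w: "w = (u, t)" by fastforce
  obtain x where x: "x \<in> X" using nonempty_X by blast
  have z': "snd h * t = fst h \<bullet> u" if "h \<in> N" for h using z[OF that] w by (simp add: inner_prod_def)
  have "t *\<^sub>R x = u"
  proof (rule ccontr)
    assume "t *\<^sub>R x \<noteq> u"
    \<comment> \<open>Orienting \<open>v\<close> by the sign of \<open>t\<close> makes the slacks in
      \<open>N\<close> grow along the ray in both cases.\<close>
    define v where "v = (if 0 \<le> t then t *\<^sub>R x - u else u - t *\<^sub>R x)"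
    have "v \<noteq> 0" using \<open>t *\<^sub>R x \<noteq> u\<close> by (auto simp: v_def)
    then obtain s where s: "0 < s" "x + s *\<^sub>R v \<in> frontier X" using ray_frontier x by blast
    then obtain h where h: "h \<in> N" "slack h (x + s *\<^sub>R v) = 0" using N by blast
    have "slack h (x + s *\<^sub>R v) = (1 + s * \<bar>t\<bar>) * slack h x"
      using z'[OF h(1)] by (auto simp: v_def slack_def inner_simps algebra_simps)
    moreover have "0 < slack h x" using slack_pos x h N by blast
    moreover have "0 < 1 + s * \<bar>t\<bar>" using s by (simp add: add_pos_nonneg)
    ultimately show False using h by simp
  qed
  moreover have "t = 0"
  proof -
    obtain p where "p \<in> frontier X" using ray_frontier[OF x, of "SOME b. b \<in> Basis"]
      by (metis SOME_Basis nonzero_Basis)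
    then obtain h where h: "h \<in> N" using N by blast
    then have "0 < slack h x" using slack_pos x N by blast
    moreover have "t * slack h x = 0" using z'[OF h] \<open>t *\<^sub>R x = u\<close>
      by (auto simp: slack_def algebra_simps)
    ultimately show ?thesis by simp
  qed
  ultimately show ?thesis using w by (simp add: zero_prod_def)
qed

lemma connected_frontier:
  assumes "DIM('a) \<noteq> 1" shows "connected (frontier X)"
proof -
  have ne: "interior X \<noteq> {}" using open_X nonempty_X by (simp add: interior_open)
  have "aff_dim X \<noteq> 1" using assms ne by (simp add: aff_dim_nonempty_interior)
  then have "connected (rel_frontier X)" by (intro connected_sphere_gen convex_X bounded_X)
  then show ?thesis using ne by (simp add: rel_frontier_nonempty_interior)
qed

text \<open>The three points are collinear, and a frontier point cannot be the middle one: the open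
  segment from a point of \<open>X\<close> to a closure point lies in \<open>X\<close>.\<close>

lemma one_dim_between:
  assumes dim: "DIM('a) = 1" and p: "p \<in> frontier X" "q \<in> frontier X" "p \<noteq> q" and x: "x \<in> X"
  obtains s where "0 < s" "s < 1" "x = q + s *\<^sub>R (p - q)"
proof -
  have "aff_dim {p, q, x} \<le> 1" using aff_dim_le_DIM[of "{p, q, x}"] dim by simp
  then have "collinear {p, q, x}" by (simp add: collinear_aff_dim)
  then have b: "between (q, x) p \<or> between (x, p) q \<or> between (p, q) x"
    by (simp add: collinear_between_cases)
  have end': "\<not> between (b, x) a" if "a \<in> frontier X" "b \<in> frontier X" "a \<noteq> b" for a b
  proof
    assume "between (b, x) a"
    then have "a \<in> open_segment x b"
      using that x frontierD by (auto simp: between_mem_segment open_segment_def closed_segment_commute)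
    moreover have "open_segment x b \<subseteq> interior X"
      using x that frontierD open_X convex_X by (intro in_interior_closure_convex_segment) (auto simp: interior_open)
    ultimately show False using that frontierD open_X by (auto simp: interior_open)
  qed
  have "between (p, q) x" using b end'[of p q] end'[of q p] p
    by (metis between_commute)
  then have "x \<in> open_segment q p"
    using p x frontierD by (auto simp: between_mem_segment open_segment_def closed_segment_commute)
  then show ?thesis using that by (auto simp: in_segment algebra_simps)
qed

end

subsection \<open>Isometries extending to the boundary\<close>

locale polytope_isometry = X: open_polytope H X + Y: open_polytope K Y
  for H :: "('a::euclidean_space \<times> real) set" and X K and Y :: "'a set" +
  fixes G F :: "'a \<Rightarrow> 'a"
  assumes continuous_G: "continuous_on (closure X) G" and continuous_F: "continuous_on (closure Y) F"
    and G_closure: "G ` closure X \<subseteq> closure Y" and F_closure: "F ` closure Y \<subseteq> closure X"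
    and G_image: "G ` X = Y" and F_G: "\<And>x. x \<in> X \<Longrightarrow> F (G x) = x"
    and isometry: "\<And>x y. x \<in> X \<Longrightarrow> y \<in> X \<Longrightarrow> Y.hratio (G x) (G y) = X.hratio x y"
begin

lemma G_in: "x \<in> X \<Longrightarrow> G x \<in> Y"
  using G_image by blast

lemma F_in: "y \<in> Y \<Longrightarrow> F y \<in> X"
  using G_image F_G by force

lemma G_F: "y \<in> Y \<Longrightarrow> G (F y) = y"
  using G_image F_G by force

lemma F_G_closure: assumes "x \<in> closure X" shows "F (G x) = x"
proof -
  have "continuous_on (closure X) (\<lambda>x. F (G x) - x)"
    by (intro continuous_intros continuous_on_compose2[OF continuous_F continuous_G G_closure])
  then have "F (G x) - x = 0"
    by (rule continuous_constant_on_closure[OF _ _ assms]) (simp add: F_G)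
  then show ?thesis by simp
qed

lemma G_F_closure: assumes "y \<in> closure Y" shows "G (F y) = y"
proof -
  have "continuous_on (closure Y) (\<lambda>x. G (F x) - x)"
    by (intro continuous_intros continuous_on_compose2[OF continuous_G continuous_F F_closure])
  then have "G (F y) - y = 0"
    by (rule continuous_constant_on_closure[OF _ _ assms]) (simp add: G_F)
  then show ?thesis by simp
qed

lemma G_frontier: assumes "p \<in> frontier X" shows "G p \<in> frontier Y"
proof -
  have p: "p \<in> closure X" "p \<notin> X" using X.frontierD assms by auto
  then have "G p \<in> closure Y" "G p \<notin> Y" using G_closure F_in F_G_closure by (blast, metis)
  then show ?thesis using Y.open_X by (simp add: frontier_def interior_open)
qed

lemma F_frontier: assumes "q \<in> frontier Y" shows "F q \<in> frontier X"
proof -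
  have p: "q \<in> closure Y" "q \<notin> Y" using Y.frontierD assms by auto
  then have "F q \<in> closure X" "F q \<notin> X" using F_closure G_in G_F_closure by (blast, metis)
  then show ?thesis using X.open_X by (simp add: frontier_def interior_open)
qed

lemma inj_frontier: "p \<in> frontier X \<Longrightarrow> q \<in> frontier X \<Longrightarrow> G p = G q \<Longrightarrow> p = q"
  using F_G_closure X.frontierD by metis

text \<open>Pieces of the frontier are indexed by a half-space of each polytope, since it is not
  known in advance that \<open>G\<close> maps a facet into a single facet.\<close>

definition smooth_points :: "('a \<times> real) \<times> ('a \<times> real) \<Rightarrow> 'a set" where
  "smooth_points r = {p. X.smooth p \<and> slack (fst r) p = 0 \<and> slack (snd r) (G p) = 0}"

definition quot :: "('a \<times> real) \<times> ('a \<times> real) \<Rightarrow> 'a \<Rightarrow> real" where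
  "quot r x = slack (fst r) x / slack (snd r) (G x)"

definition funk_quot :: "'a \<Rightarrow> 'a \<Rightarrow> real" where
  "funk_quot p x = funk H p x / funk K (G p) (G x)"

lemma quot_pos: "r \<in> H \<times> K \<Longrightarrow> x \<in> X \<Longrightarrow> 0 < quot r x"
  unfolding quot_def using X.slack_pos Y.slack_pos G_in by (auto simp: mem_Times_iff)

lemma funk_quot_pos: "x \<in> X \<Longrightarrow> 0 < funk_quot p x"
  unfolding funk_quot_def using X.funk_pos Y.funk_pos G_in by simp

text \<open>Smoothness gives the horofunction a limit at \<open>p\<close>, and the isometry carries
  this limit to \<open>G p\<close>. Evaluating it by \<open>hratio_limit\<close> on both sides
  yields the relation.\<close>

lemma smooth_quot:
  assumes r: "r \<in> H \<times> K" and p: "p \<in> smooth_points r" and x: "x \<in> X" "y \<in> X"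
  shows "quot r x * funk_quot p x = quot r y * funk_quot p y"
proof -
  have p': "X.smooth p" "p \<in> frontier X" "slack (fst r) p = 0" "slack (snd r) (G p) = 0"
    using p by (auto simp: smooth_points_def X.smooth_def)
  have r': "fst r \<in> H" "snd r \<in> K" using r by auto
  have Gp: "G p \<in> frontier Y" using G_frontier p' by simp
  obtain l where l: "((\<lambda>z. X.hratio x z / X.hratio y z) \<longlongrightarrow> l) (at p within X)"
    using X.smooth_hratio_limit[OF p'(1) x] .
  \<comment> \<open>Continuity of the extended inverse turns \<open>w\<close> tending to
    \<open>G p\<close> into \<open>F w\<close> tending to \<open>p\<close>, so the limit can be
    pulled over to \<open>Y\<close>.\<close>
  have "(F \<longlongrightarrow> F (G p)) (at (G p) within Y)"
    using continuous_F Y.frontierD(1)[OF Gp] closure_subset[of Y]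
    by (auto simp: continuous_on_def intro: tendsto_within_subset)
  then have "(F \<longlongrightarrow> p) (at (G p) within Y)" using F_G_closure X.frontierD(1) p' by simp
  moreover have "\<forall>\<^sub>F w in at (G p) within Y. F w \<in> X \<and> F w \<noteq> p"
    unfolding eventually_at_filter using F_in X.frontierD(2)[OF p'(2)] by (intro always_eventually) force
  ultimately have "filterlim F (at p within X) (at (G p) within Y)"
    unfolding filterlim_at by simp
  then have "((\<lambda>w. X.hratio x (F w) / X.hratio y (F w)) \<longlongrightarrow> l) (at (G p) within Y)"
    by (rule filterlim_compose[OF l])
  moreover have "\<forall>\<^sub>F w in at (G p) within Y. X.hratio x (F w) / X.hratio y (F w)
      = Y.hratio (G x) w / Y.hratio (G y) w"
    unfolding eventually_at_filter
  proof (intro always_eventually allI impI)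
    fix w assume "w \<in> Y"
    then show "X.hratio x (F w) / X.hratio y (F w) = Y.hratio (G x) w / Y.hratio (G y) w"
      using isometry[OF x(1), of "F w"] isometry[OF x(2), of "F w"] F_in G_F by simp
  qed
  ultimately have l2: "((\<lambda>w. Y.hratio (G x) w / Y.hratio (G y) w) \<longlongrightarrow> l) (at (G p) within Y)"
    using tendsto_cong by force
  have "slack (fst r) x * funk H p x / (slack (fst r) y * funk H p y)
    = slack (snd r) (G x) * funk K (G p) (G x) / (slack (snd r) (G y) * funk K (G p) (G y))"
    using X.hratio_limit[OF p'(2) r'(1) p'(3) x l]
      Y.hratio_limit[OF Gp r'(2) p'(4) G_in[OF x(1)] G_in[OF x(2)] l2] by simp
  moreover have "0 < slack (fst r) y" "0 < slack (snd r) (G x)" "0 < slack (snd r) (G y)"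
    "0 < funk H p y" "0 < funk K (G p) (G x)" "0 < funk K (G p) (G y)"
    using X.slack_pos Y.slack_pos X.funk_pos Y.funk_pos x r' G_in by auto
  ultimately show ?thesis
    unfolding quot_def funk_quot_def by (simp add: frac_eq_eq mult_ac)
qed

lemma closure_smooth_points:
  assumes "p \<in> closure (smooth_points r)"
  shows "p \<in> frontier X" "slack (fst r) p = 0" "slack (snd r) (G p) = 0"
proof -
  have sub: "smooth_points r \<subseteq> frontier X" by (auto simp: smooth_points_def X.smooth_def)
  then have c: "closure (smooth_points r) \<subseteq> frontier X" by (simp add: closure_minimal)
  then show "p \<in> frontier X" using assms by blast
  have cont: "continuous_on (closure (smooth_points r)) G"
    using continuous_G c by (metis continuous_on_subset frontier_def Diff_subset subset_trans)
  show "slack (fst r) p = 0"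
    by (rule continuous_constant_on_closure[OF _ _ assms])
      (auto intro!: continuous_intros simp: smooth_points_def)
  have "continuous_on (closure (smooth_points r)) (\<lambda>p. slack (snd r) (G p))"
    by (intro continuous_intros cont)
  then show "slack (snd r) (G p) = 0"
    by (rule continuous_constant_on_closure[OF _ _ assms]) (simp add: smooth_points_def)
qed

text \<open>For fixed \<open>x\<close> and \<open>y\<close> both sides are continuous in
  \<open>p\<close>. The relation thus reaches the points where different pieces meet.\<close>

lemma closure_smooth_quot:
  assumes r: "r \<in> H \<times> K" and p: "p \<in> closure (smooth_points r)" and x: "x \<in> X" "y \<in> X"
  shows "quot r x * funk_quot p x = quot r y * funk_quot p y"
proof -
  have c: "closure (smooth_points r) \<subseteq> closure X"
    using closure_smooth_points(1) X.frontierD(1) by blast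
  have cont: "continuous_on (closure (smooth_points r)) G"
    using continuous_G c by (metis continuous_on_subset)
  have "continuous_on (closure (smooth_points r)) (\<lambda>p. funk_quot p z)" if z: "z \<in> X" for z
    unfolding funk_quot_def using Y.funk_pos[OF G_in[OF z]]
    by (intro continuous_on_divide X.continuous_on_funk Y.continuous_on_funk continuous_on_id z G_in cont)
      (simp add: less_imp_neq[symmetric])
  then have "continuous_on (closure (smooth_points r)) (\<lambda>p. quot r x * funk_quot p x - quot r y * funk_quot p y)"
    using x by (intro continuous_intros) auto
  then have "quot r x * funk_quot p x - quot r y * funk_quot p y = 0"
    by (rule continuous_constant_on_closure[OF _ _ p]) (simp add: smooth_quot[OF r _ x])
  then show ?thesis by simp
qed

text \<open>Smooth points are dense in the frontier, and a finite union of closures is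
  closed.\<close>

lemma smooth_points_cover: "frontier X = (\<Union>r\<in>H \<times> K. closure (smooth_points r))"
proof
  have "Collect X.smooth \<subseteq> (\<Union>r\<in>H \<times> K. smooth_points r)"
  proof
    fix p assume "p \<in> Collect X.smooth"
    then have p: "X.smooth p" "p \<in> frontier X" by (auto simp: X.smooth_def)
    obtain i where "i \<in> H" "slack i p = 0" using X.frontier_active p by blast
    moreover obtain j where "j \<in> K" "slack j (G p) = 0" using Y.frontier_active G_frontier p by blast
    ultimately have "(i, j) \<in> H \<times> K" "p \<in> smooth_points (i, j)"
      using p by (auto simp: smooth_points_def)
    then show "p \<in> (\<Union>r\<in>H \<times> K. smooth_points r)" by blast
  qed
  also have "\<dots> \<subseteq> (\<Union>r\<in>H \<times> K. closure (smooth_points r))"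
    using closure_subset by blast
  finally have "closure (Collect X.smooth) \<subseteq> (\<Union>r\<in>H \<times> K. closure (smooth_points r))"
    using X.finite_H Y.finite_H by (intro closure_minimal closed_UN) auto
  then show "frontier X \<subseteq> (\<Union>r\<in>H \<times> K. closure (smooth_points r))"
    using X.smooth_dense by blast
qed (use closure_smooth_points(1) in blast)

section \<open>Proportionality of the quotients across the frontier\<close>

definition proportional :: "('a \<times> real) \<times> ('a \<times> real) \<Rightarrow> ('a \<times> real) \<times> ('a \<times> real) \<Rightarrow> bool" where
  "proportional r s \<longleftrightarrow> (\<forall>x\<in>X. \<forall>y\<in>X. quot r x * quot s y = quot r y * quot s x)"

text \<open>At a common point \<open>p\<close> both relations involve the same positive function
  \<open>funk_quot p\<close>, which cancels.\<close>

lemma proportional_meet: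
  assumes "r \<in> H \<times> K" "s \<in> H \<times> K"
    and p: "p \<in> closure (smooth_points r)" "p \<in> closure (smooth_points s)"
  shows "proportional r s"
  unfolding proportional_def
proof (intro ballI)
  fix x y assume x: "x \<in> X" "y \<in> X"
  have "(quot r x * quot s y) * (funk_quot p x * funk_quot p y) = (quot r x * funk_quot p x) * (quot s y * funk_quot p y)"
    by simp
  also have "\<dots> = (quot r y * funk_quot p y) * (quot s x * funk_quot p x)"
    using closure_smooth_quot[OF assms(1) p(1) x] closure_smooth_quot[OF assms(2) p(2) x] by simp
  also have "\<dots> = (quot r y * quot s x) * (funk_quot p x * funk_quot p y)" by simp
  finally show "quot r x * quot s y = quot r y * quot s x"
    using funk_quot_pos[OF x(1), of p] funk_quot_pos[OF x(2), of p] by simp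
qed

lemma proportional_trans:
  assumes "proportional r s" "proportional s t" "s \<in> H \<times> K"
  shows "proportional r t"
  unfolding proportional_def
proof (intro ballI)
  fix x y assume x: "x \<in> X" "y \<in> X"
  have "(quot r x * quot t y) * (quot s x * quot s y) = (quot r x * quot s y) * (quot s x * quot t y)"
    by simp
  also have "\<dots> = (quot r y * quot s x) * (quot s y * quot t x)"
    using assms(1,2) x unfolding proportional_def by simp
  also have "\<dots> = (quot r y * quot t x) * (quot s x * quot s y)" by simp
  finally show "quot r x * quot t y = quot r y * quot t x"
    using quot_pos[OF assms(3) x(1)] quot_pos[OF assms(3) x(2)] by simp
qed

text \<open>The frontier of an interval is disconnected, but there \<open>funk H p\<close> is itself the reciprocal of the
  slack at the opposite end point, up to a constant.\<close>

lemma proportional_one_dim: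
  assumes dim: "DIM('a) = 1" and rs: "r \<in> H \<times> K" "s \<in> H \<times> K"
    and p: "p \<in> closure (smooth_points r)" and q: "q \<in> closure (smooth_points s)" and "p \<noteq> q"
  shows "proportional r s"
proof -
  note P = closure_smooth_points[OF p] and Q = closure_smooth_points[OF q]
  have fX: "funk H p x * slack (fst s) x = slack (fst s) p" if x: "x \<in> X" for x
  proof -
    obtain t where t: "0 < t" "t < 1" "x = q + t *\<^sub>R (p - q)"
      using X.one_dim_between[OF dim P(1) Q(1) \<open>p \<noteq> q\<close> x] .
    then have "funk H p x = 1 / t" using Q(1) x by (intro X.funk_chord) auto
    moreover have "slack (fst s) x = t * slack (fst s) p" using t Q by (simp add: slack_affine)
    ultimately show ?thesis using t by simp
  qed
  have fY: "funk K (G p) y * slack (snd s) y = slack (snd s) (G p)" if y: "y \<in> Y" for y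
  proof -
    obtain t where t: "0 < t" "t < 1" "y = G q + t *\<^sub>R (G p - G q)"
      using Y.one_dim_between[OF dim G_frontier[OF P(1)] G_frontier[OF Q(1)] _ y] inj_frontier[OF P(1) Q(1)] \<open>p \<noteq> q\<close>
      by blast
    then have "funk K (G p) y = 1 / t" using Q(1) y G_frontier by (intro Y.funk_chord) auto
    moreover have "slack (snd s) y = t * slack (snd s) (G p)" using t Q by (simp add: slack_affine)
    ultimately show ?thesis using t by simp
  qed
  \<comment> \<open>Independence of \<open>x\<close> replaces the second use of
    \<open>closure_smooth_quot\<close> that a common point would allow.\<close>
  have c: "funk_quot p x * quot s x = slack (fst s) p / slack (snd s) (G p)" if "x \<in> X" for x
    unfolding funk_quot_def quot_def using fX[OF that] fY[OF G_in[OF that]] by simp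
  show ?thesis
    unfolding proportional_def
  proof (intro ballI)
    fix x y assume x: "x \<in> X" "y \<in> X"
    have "(quot r x * quot s y) * (funk_quot p x * funk_quot p y) = (quot r x * funk_quot p x) * (funk_quot p y * quot s y)"
      by simp
    also have "\<dots> = (quot r y * funk_quot p y) * (funk_quot p x * quot s x)"
      using closure_smooth_quot[OF rs(1) p x] c[OF x(1)] c[OF x(2)] by simp
    also have "\<dots> = (quot r y * quot s x) * (funk_quot p x * funk_quot p y)" by simp
    finally show "quot r x * quot s y = quot r y * quot s x"
      using funk_quot_pos[OF x(1), of p] funk_quot_pos[OF x(2), of p] by simp
  qed
qed

text \<open>Only pairs with a nonempty piece carry a relation between their slacks; for other pairs
  the quotients need not be proportional.\<close>

definition faces :: "(('a \<times> real) \<times> ('a \<times> real)) set" where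
  "faces = {r \<in> H \<times> K. smooth_points r \<noteq> {}}"

lemma frontier_faces: assumes "p \<in> frontier X" obtains r where "r \<in> faces" "p \<in> closure (smooth_points r)"
  using assms that unfolding smooth_points_cover faces_def by fastforce

text \<open>Outside dimension one, the pieces proportional to \<open>r\<close> and the remaining
  ones form two closed sets covering the connected frontier. They are disjoint there by
  \<open>proportional_meet\<close> and transitivity, so the second misses the frontier.\<close>

lemma proportional_faces:
  assumes r: "r \<in> faces" "s \<in> faces" shows "proportional r s"
proof -
  have HK: "r \<in> H \<times> K" "s \<in> H \<times> K" using r by (auto simp: faces_def)
  obtain p q where p: "p \<in> closure (smooth_points r)" and q: "q \<in> closure (smooth_points s)"
    using r closure_subset unfolding faces_def by blast
  show ?thesis
  proof (cases "DIM('a) = 1")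
    case True
    then show ?thesis
      using proportional_one_dim[OF True HK p q] proportional_meet[OF HK p] q by blast
  next
    case False
    define A where "A = (\<Union>t\<in>{t \<in> H \<times> K. proportional r t}. closure (smooth_points t))"
    define B where "B = (\<Union>t\<in>{t \<in> H \<times> K. \<not> proportional r t}. closure (smooth_points t))"
    have fin: "finite (H \<times> K)" using X.finite_H Y.finite_H by simp
    have "closed A" "closed B" unfolding A_def B_def using fin by (auto intro!: closed_UN)
    moreover have "A \<inter> B \<inter> frontier X = {}"
    proof (rule ccontr)
      assume "A \<inter> B \<inter> frontier X \<noteq> {}"
      then obtain z where "z \<in> A" "z \<in> B" by blast
      obtain t where "t \<in> H \<times> K" "proportional r t" "z \<in> closure (smooth_points t)"
        using \<open>z \<in> A\<close> unfolding A_def by (elim UN_E CollectE conjE)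
      moreover obtain u where "u \<in> H \<times> K" "\<not> proportional r u" "z \<in> closure (smooth_points u)"
        using \<open>z \<in> B\<close> unfolding B_def by (elim UN_E CollectE conjE)
      ultimately show False using proportional_meet[of t u z] proportional_trans[of r t u] by simp
    qed
    moreover have "frontier X \<subseteq> A \<union> B"
    proof
      fix z assume "z \<in> frontier X"
      then obtain t where "t \<in> H \<times> K" "z \<in> closure (smooth_points t)"
        using smooth_points_cover by (elim equalityE) blast
      then show "z \<in> A \<union> B" unfolding A_def B_def by blast
    qed
    moreover have "p \<in> A \<inter> frontier X"
    proof -
      have "proportional r r" by (simp add: proportional_def mult.commute)
      then show ?thesis unfolding A_def using p HK(1) closure_smooth_points(1)[OF p] by blast
    qed
    ultimately have empty: "B \<inter> frontier X = {}"
      using connected_closedD[OF X.connected_frontier[OF False], of A B] by blast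
    show ?thesis
    proof (rule ccontr)
      assume "\<not> proportional r s"
      then have "q \<in> B" unfolding B_def using q HK(2) by blast
      then show False using empty closure_smooth_points(1)[OF q] by blast
    qed
  qed
qed

end

subsection \<open>Linearization\<close>

text \<open>\<open>T w\<close> is the vector whose values under all \<open>m r\<close> are those of
  \<open>w\<close> under \<open>l r\<close>. Solvability extends from \<open>S\<close> to its span,
  uniqueness by \<open>m0\<close> gives linearity, and \<open>l0\<close> gives injectivity, hence
  bijectivity in finite dimension.\<close>

lemma linear_bij_of_functionals:
  fixes l m :: "'i \<Rightarrow> 'b::euclidean_space"
  assumes span: "span S = UNIV"
    and ex: "\<And>w. w \<in> S \<Longrightarrow> \<exists>v. \<forall>r\<in>I. l r \<bullet> w = m r \<bullet> v"
    and l0: "\<And>w. (\<And>r. r \<in> I \<Longrightarrow> l r \<bullet> w = 0) \<Longrightarrow> w = 0"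
    and m0: "\<And>w. (\<And>r. r \<in> I \<Longrightarrow> m r \<bullet> w = 0) \<Longrightarrow> w = 0"
  obtains T where "linear T" "bij T" "\<And>r w. r \<in> I \<Longrightarrow> l r \<bullet> w = m r \<bullet> T w"
proof -
  let ?W = "{w. \<exists>v. \<forall>r\<in>I. l r \<bullet> w = m r \<bullet> v}"
  have "subspace ?W"
  proof (rule subspaceI)
    show "0 \<in> ?W" by (auto intro!: exI[of _ 0])
  next
    fix x y assume "x \<in> ?W" "y \<in> ?W"
    then obtain u v where "\<forall>r\<in>I. l r \<bullet> x = m r \<bullet> u" "\<forall>r\<in>I. l r \<bullet> y = m r \<bullet> v" by blast
    then show "x + y \<in> ?W" by (auto intro!: exI[of _ "u + v"] simp: inner_add_right)
  next
    fix c x assume "x \<in> ?W"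
    then obtain u where "\<forall>r\<in>I. l r \<bullet> x = m r \<bullet> u" by blast
    then show "c *\<^sub>R x \<in> ?W" by (auto intro!: exI[of _ "c *\<^sub>R u"])
  qed
  moreover have "S \<subseteq> ?W" using ex by blast
  ultimately have "span S \<subseteq> ?W" by (rule span_minimal[rotated])
  then have "\<forall>w. \<exists>v. \<forall>r\<in>I. l r \<bullet> w = m r \<bullet> v" using span by auto
  then obtain T where T: "\<And>w r. r \<in> I \<Longrightarrow> l r \<bullet> w = m r \<bullet> T w" by metis
  have eq: "u = v" if "\<And>r. r \<in> I \<Longrightarrow> m r \<bullet> u = m r \<bullet> v" for u v
    using m0[of "u - v"] that by (simp add: inner_diff_right)
  have lin: "linear T"
  proof
    show "T (x + y) = T x + T y" for x y
      by (rule eq) (simp add: inner_add_right T[symmetric])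
    show "T (c *\<^sub>R x) = c *\<^sub>R T x" for c x
      by (rule eq) (simp add: T[symmetric])
  qed
  have "inj T"
    unfolding linear_injective_0[OF lin]
    using T l0 by (metis inner_zero_right)
  then have "bij T" using lin linear_inj_imp_surj by (auto simp: bij_def)
  then show ?thesis using that lin T by blast
qed

text \<open>Differences of lifted points near \<open>x0\<close> give every \<open>(v, 0)\<close>
  after rescaling, and \<open>(x0, 1)\<close> supplies the last coordinate.\<close>

lemma span_homogeneous_open:
  fixes X :: "'a::euclidean_space set"
  assumes "open X" "x0 \<in> X"
  shows "span ((\<lambda>x. (x, 1::real)) ` X) = UNIV"
proof -
  let ?S = "span ((\<lambda>x. (x, 1::real)) ` X)"
  have base: "(x, 1) \<in> ?S" if "x \<in> X" for x using that by (auto intro: span_base)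
  obtain e where e: "0 < e" "ball x0 e \<subseteq> X" using assms open_contains_ball by blast
  have dir: "(v, 0) \<in> ?S" for v
  proof -
    \<comment> \<open>The summand 1 keeps the denominator of \<open>c\<close> positive when
      \<open>v\<close> is zero.\<close>
    define N where "N = norm v + 1"
    define c where "c = e / (2 * N)"
    have np: "0 < N" by (simp add: N_def add_nonneg_pos)
    then have c: "0 < c" using e by (simp add: c_def)
    have "norm (c *\<^sub>R v) < e"
    proof -
      have "norm (c *\<^sub>R v) = c * norm v" using c by simp
      also have "\<dots> < c * N" using c by (simp add: N_def)
      also have "\<dots> = e / 2" using np by (simp add: c_def)
      finally show ?thesis using e by simp
    qed
    then have "x0 + c *\<^sub>R v \<in> X" using e by (auto simp: dist_norm subset_iff)
    then have "(x0 + c *\<^sub>R v, 1) - (x0, 1) \<in> ?S" using base assms by (intro span_diff) auto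
    then have "(1 / c) *\<^sub>R ((x0 + c *\<^sub>R v, 1) - (x0, 1)) \<in> ?S" by (rule span_scale)
    then show ?thesis using c by simp
  qed
  have "(v, t) \<in> ?S" for v t
  proof -
    have "(v - t *\<^sub>R x0, 0) + t *\<^sub>R (x0, 1) \<in> ?S"
      by (intro span_add span_scale base assms dir)
    then show ?thesis by simp
  qed
  then show ?thesis by auto
qed

context polytope_isometry
begin

lemma projective:
  obtains T :: "'a \<times> real \<Rightarrow> 'a \<times> real" and \<psi> :: "'a \<Rightarrow> real"
  where "linear T" "bij T" "\<And>x. x \<in> X \<Longrightarrow> \<psi> x \<noteq> 0 \<and> T (x, 1) = \<psi> x *\<^sub>R (G x, 1)"
proof -
  obtain x0 where x0: "x0 \<in> X" using X.nonempty_X by blast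
  obtain p0 where "p0 \<in> frontier X" using X.ray_frontier[OF x0, of "SOME b. b \<in> Basis"]
    by (metis SOME_Basis nonzero_Basis)
  then obtain s where s: "s \<in> faces" using frontier_faces by blast
  then have sHK: "s \<in> H \<times> K" by (simp add: faces_def)
  \<comment> \<open>The constant ratio of \<open>quot r\<close> to \<open>quot s\<close>, read off
    at \<open>x0\<close>. Absorbing it into \<open>m r\<close> lets the single function
    \<open>quot s\<close> serve as \<open>\<psi>\<close> for all faces.\<close>
  define c where "c r = quot r x0 / quot s x0" for r
  define l where "l r = (- fst (fst r), snd (fst r))" for r :: "('a \<times> real) \<times> ('a \<times> real)"
  define m where "m r = c r *\<^sub>R (- fst (snd r), snd (snd r))" for r :: "('a \<times> real) \<times> ('a \<times> real)"
  have cpos: "0 < c r" if "r \<in> faces" for r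
    using quot_pos[of r x0] quot_pos[OF sHK x0] that x0 by (simp add: c_def faces_def)
  have l: "l r \<bullet> (x, 1) = slack (fst r) x" for r x by (simp add: l_def slack_def inner_prod_def)
  have m: "m r \<bullet> (y, 1) = c r * slack (snd r) y" for r y by (simp add: m_def slack_def inner_prod_def algebra_simps)
  have lm: "l r \<bullet> (x, 1) = m r \<bullet> (quot s x *\<^sub>R (G x, 1))" if r: "r \<in> faces" and x: "x \<in> X" for r x
  proof -
    have "quot r x * quot s x0 = quot r x0 * quot s x"
      using proportional_faces[OF r s] x x0 unfolding proportional_def by blast
    then have "quot r x = c r * quot s x"
      using quot_pos[OF sHK x0] by (simp add: c_def field_simps)
    moreover have "slack (fst r) x = quot r x * slack (snd r) (G x)"
      using r Y.slack_pos[OF G_in[OF x], of "snd r"] by (auto simp: quot_def faces_def)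
    ultimately show ?thesis by (simp only: l m inner_scaleR_right mult_ac)
  qed
  have l0: "w = 0" if z: "\<And>r. r \<in> faces \<Longrightarrow> l r \<bullet> w = 0" for w
  proof (rule X.slack_homogeneous_zero)
    show "fst ` faces \<subseteq> H" by (auto simp: faces_def)
    show "\<exists>h\<in>fst ` faces. slack h p = 0" if "p \<in> frontier X" for p
      using frontier_faces[OF that] closure_smooth_points(2) by (metis image_eqI)
    show "(- fst h, snd h) \<bullet> w = 0" if "h \<in> fst ` faces" for h
      using that z by (auto simp: l_def)
  qed
  have m0: "w = 0" if z: "\<And>r. r \<in> faces \<Longrightarrow> m r \<bullet> w = 0" for w
  proof (rule Y.slack_homogeneous_zero)
    show "snd ` faces \<subseteq> K" by (auto simp: faces_def)
    show "\<exists>h\<in>snd ` faces. slack h q = 0" if q: "q \<in> frontier Y" for q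
    proof -
      obtain r where "r \<in> faces" "F q \<in> closure (smooth_points r)"
        using frontier_faces[OF F_frontier[OF q]] .
      then show ?thesis
        using closure_smooth_points(3)[of "F q" r] G_F_closure[OF Y.frontierD(1)[OF q]] by auto
    qed
    show "(- fst h, snd h) \<bullet> w = 0" if "h \<in> snd ` faces" for h
    proof -
      obtain r where r: "r \<in> faces" "h = snd r" using \<open>h \<in> snd ` faces\<close> by auto
      then have "c r * ((- fst h, snd h) \<bullet> w) = 0" using z[OF r(1)] by (simp only: m_def inner_scaleR_left r(2))
      then show ?thesis using cpos[OF r(1)] by simp
    qed
  qed
  have "\<exists>v. \<forall>r\<in>faces. l r \<bullet> w = m r \<bullet> v" if "w \<in> (\<lambda>x. (x, 1)) ` X" for w
  proof -
    obtain x where "x \<in> X" "w = (x, 1)" using \<open>w \<in> _\<close> by blast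
    then show ?thesis using lm by (intro exI[of _ "quot s x *\<^sub>R (G x, 1)"] ballI) (simp only:)
  qed
  from linear_bij_of_functionals[OF span_homogeneous_open[OF X.open_X x0] this l0 m0]
  obtain T where T: "linear T" "bij T" "\<And>r w. r \<in> faces \<Longrightarrow> l r \<bullet> w = m r \<bullet> T w" by blast
  have "quot s x \<noteq> 0 \<and> T (x, 1) = quot s x *\<^sub>R (G x, 1)" if x: "x \<in> X" for x
  proof -
    have "T (x, 1) - quot s x *\<^sub>R (G x, 1) = 0"
      by (rule m0) (simp only: inner_diff_right T(3)[symmetric] lm[OF _ x] diff_self)
    then show ?thesis using quot_pos[OF sHK x] by simp
  qed
  then show ?thesis using that[OF T(1,2), of "quot s"] by blast
qed

end

section \<open>Hilbert distance and projective matrices in terms of slacks and linear maps\<close>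

lemma chord_end_ratio:
  assumes P: "open_polytope H X" and xy: "x \<in> X" "y \<in> X" "x \<noteq> y"
  shows "dist (chord_end X x y) y / dist (chord_end X x y) x = funk H y x"
proof -
  interpret open_polytope H X by (rule P)
  obtain s where s: "0 < s" "x + s *\<^sub>R (x - y) \<in> frontier X"
    using ray_frontier[OF xy(1), of "x - y"] xy by auto
  \<comment> \<open>The weight of \<open>y\<close> when \<open>x\<close> is written as a convex
    combination of the frontier point \<open>q\<close> and \<open>y\<close>. This exhibits a chord
    end, so the choice in \<open>chord_end\<close> has a witness.\<close>
  define t where "t = s / (1 + s)"
  have t: "0 < t" "t < 1" "(1 - t) * s - t = 0" using s by (simp_all add: t_def field_simps)
  define q where "q = x + s *\<^sub>R (x - y)"
  have "(1 - t) *\<^sub>R q + t *\<^sub>R y = x + ((1 - t) * s - t) *\<^sub>R (x - y)"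
    by (simp add: q_def algebra_simps)
  also have "\<dots> = x" by (simp only: t(3) scaleR_zero_left add_0_right)
  finally have "x = (1 - t) *\<^sub>R q + t *\<^sub>R y" ..
  moreover have q: "q \<in> frontier X" using s by (simp add: q_def)
  moreover have "q \<noteq> y" using frontierD(2)[OF q] xy(2) by metis
  ultimately have "\<exists>p. p \<in> frontier X \<and> x \<in> open_segment p y"
    unfolding in_segment using t(1,2) by metis
  then have ends: "chord_end X x y \<in> frontier X \<and> x \<in> open_segment (chord_end X x y) y"
    unfolding chord_end_def by (rule someI_ex)
  define p where "p = chord_end X x y"
  have p: "p \<in> frontier X" "x \<in> open_segment p y" using ends by (auto simp: p_def)
  then obtain t where t: "0 < t" "t < 1" "x = (1 - t) *\<^sub>R p + t *\<^sub>R y" unfolding in_segment by blast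
  then have x: "x = p + t *\<^sub>R (y - p)" by (simp add: algebra_simps)
  have "funk H y x = 1 / t" by (rule funk_chord[OF p(1) _ _ xy(1) x]) (use t in auto)
  moreover have "dist p x = t * dist p y"
    using t(1) arg_cong[OF x, of "\<lambda>z. norm (z - p)"] by (simp add: dist_norm norm_minus_commute)
  moreover have "p \<noteq> y" using p xy frontierD(2) by auto
  ultimately show ?thesis
    using t(1) unfolding p_def[symmetric] by simp_all
qed

text \<open>The cross-ratio regroups into one ratio of distances per chord end, each evaluated by
  \<open>chord_end_ratio\<close>.\<close>

lemma exp_hilbert_dist:
  assumes P: "open_polytope H X" and xy: "x \<in> X" "y \<in> X"
  shows "exp (hilbert_dist X x y) = open_polytope.hratio H x y"
proof -
  interpret open_polytope H X by (rule P)
  show ?thesis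
  proof (cases "x = y")
    case True
    then show ?thesis using xy by (simp add: hilbert_dist_def hratio_def)
  next
    case False
    have "hilbert_dist X x y = ln (hratio x y)"
      using chord_end_ratio[OF P xy False] chord_end_ratio[OF P xy(2,1) False[symmetric]] False
      by (simp only: hilbert_dist_def hratio_def Let_def times_divide_times_eq[symmetric] if_False mult.commute[of "funk H x y"])
    then show ?thesis using hratio_pos[OF xy] by simp
  qed
qed

lemma polyhedral_open_polytope:
  assumes "polyhedral_hilbert_geometry X" obtains H where "open_polytope H X"
proof -
  obtain H where "X \<noteq> {}" "bounded X" "finite H" "X = (\<Inter>(a, b)\<in>H. {x. a \<bullet> x < b})"
    using assms unfolding polyhedral_hilbert_geometry_def by blast
  then have "open_polytope H X" by unfold_locales (auto simp: slack_def)
  then show ?thesis using that by blast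
qed

lemma collineation_of_linear:
  fixes T :: "(real ^ 'n) \<times> real \<Rightarrow> (real ^ 'n) \<times> real"
  assumes T: "linear T" "bij T"
    and g: "\<And>x. x \<in> X \<Longrightarrow> \<psi> x \<noteq> 0 \<and> T (x, 1) = \<psi> x *\<^sub>R (g x, 1)"
  shows "is_collineation_on X g"
proof -
  define A where "A = matrix (\<lambda>v. fst (T (v, 0)))"
  \<comment> \<open>The adjoint of a linear functional, evaluated at 1, is the vector representing
    it.\<close>
  define c where "c = adjoint (\<lambda>v. snd (T (v, 0))) 1"
  define b d where "b = fst (T (0, 1))" and "d = snd (T (0, 1))"
  have l0: "linear (\<lambda>v. T (v, 0))"
    using linear_compose[of "\<lambda>v. (v, 0)" T] T(1) by (auto simp: o_def linear_iff)
  have l1: "linear (\<lambda>v. fst (T (v, 0)))" "linear (\<lambda>v. snd (T (v, 0)))"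
    using linear_compose[OF l0 linear_fst] linear_compose[OF l0 linear_snd] by (auto simp: o_def)
  have A: "A *v v = fst (T (v, 0))" for v
    unfolding A_def using matrix_vector_mul(2)[OF l1(1)] by metis
  have c: "c \<bullet> v = snd (T (v, 0))" for v
    using adjoint_works[OF l1(2), of v 1] by (simp add: c_def inner_commute)
  have Tvt: "T (v, t) = (A *v v + t *\<^sub>R b, c \<bullet> v + t * d)" for v t
  proof -
    have "T ((v, 0) + t *\<^sub>R (0, 1)) = T (v, 0) + t *\<^sub>R T (0, 1)"
      by (simp only: linear_add[OF T(1)] linear_scale[OF T(1)])
    then show ?thesis by (simp add: prod_eq_iff A c b_def d_def)
  qed
  have "T = (\<lambda>(v, t). (A *v v + t *\<^sub>R b, c \<bullet> v + t * d))" using Tvt by auto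
  then have "proj_matrix_invertible A b c d" using T(2) by (simp add: proj_matrix_invertible_def)
  \<comment> \<open>The last component of \<open>T (x, 1)\<close> identifies \<open>\<psi> x\<close>
    with the denominator, which is therefore nonzero.\<close>
  moreover have "c \<bullet> x + d \<noteq> 0 \<and> g x = (1 / (c \<bullet> x + d)) *\<^sub>R (A *v x + b)" if "x \<in> X" for x
    using g[OF that] Tvt[of x 1] by auto
  ultimately show ?thesis unfolding is_collineation_on_def by blast
qed

theorem theorem6p4:
  fixes X Y :: "(real ^ 'n) set" and g :: "real ^ 'n \<Rightarrow> real ^ 'n"
  assumes "polyhedral_hilbert_geometry X"
    and "polyhedral_hilbert_geometry Y"
    and "g ` X = Y"
    and "\<forall>x \<in> X. \<forall>y \<in> X. hilbert_dist Y (g x) (g y) = hilbert_dist X x y"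
    and "\<exists>G. continuous_on (closure X) G \<and> G ` closure X \<subseteq> closure Y \<and> (\<forall>x \<in> X. G x = g x)"
    and "\<exists>H. continuous_on (closure Y) H \<and> H ` closure Y \<subseteq> closure X \<and> (\<forall>x \<in> X. H (g x) = x)"
  shows "is_collineation_on X g"
proof -
  obtain H where H: "open_polytope H X" using polyhedral_open_polytope[OF assms(1)] .
  obtain K where K: "open_polytope K Y" using polyhedral_open_polytope[OF assms(2)] .
  obtain G where G: "continuous_on (closure X) G" "G ` closure X \<subseteq> closure Y" "\<And>x. x \<in> X \<Longrightarrow> G x = g x"
    using assms(5) by blast
  obtain F where F: "continuous_on (closure Y) F" "F ` closure Y \<subseteq> closure X" "\<And>x. x \<in> X \<Longrightarrow> F (g x) = x"
    using assms(6) by blast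
  have GX: "G ` X = Y" using assms(3) G(3) by auto
  interpret polytope_isometry H X K Y G F
  proof (intro polytope_isometry.intro H K polytope_isometry_axioms.intro)
    fix x y assume xy: "x \<in> X" "y \<in> X"
    then have "G x \<in> Y" "G y \<in> Y" using GX by auto
    then show "open_polytope.hratio K (G x) (G y) = open_polytope.hratio H x y"
      using exp_hilbert_dist[OF H xy] exp_hilbert_dist[OF K, of "G x" "G y"] assms(4) xy G(3) by auto
  qed (use F G GX in auto)
  obtain T :: "(real ^ 'n) \<times> real \<Rightarrow> (real ^ 'n) \<times> real" and \<psi>
    where T: "linear T" "bij T" and \<psi>: "\<And>x. x \<in> X \<Longrightarrow> \<psi> x \<noteq> 0 \<and> T (x, 1) = \<psi> x *\<^sub>R (G x, 1)"
    by (rule projective) (rule that)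
  show ?thesis
    by (rule collineation_of_linear[OF T, of X \<psi>]) (use \<psi> G(3) in simp)
qed

end
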